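(* Suppose there exists $L_1>0$ such that $$\frac{\alpha_c}{\alpha_c+\alpha_p}\int_0^{+\infty}e^{L_1z}\,dF(z)+\frac{\alpha_p}{\alpha_c+\alpha_p}\int_0^{+\infty}e^{-L_1z}\,dG(z)\le1$$ and $\lim_{z\to\infty}e^{L_1z}(1-F(z))=0$. Let $\varphi_*(u)=1-e^{-L_1u}$, $u\ge0$. Then $\varphi_*$ is a nondecreasing function with $0\le\varphi_*(u)\le1$ and $\lim_{u\to+\infty}\varphi_*(u)=1$, and $A_1\varphi_*(u)\ge\varphi_*(u)$ for all $u\ge0$.
   Context: $\alpha_c,\alpha_p>0$ are constants; $F$ and $G$ are distribution functions of nonnegative random variables (claims and premiums). For a bounded Borel function $\varphi$ on $[0,+\infty)$ and $u\ge0$, $$A_1\varphi(u)=\frac{\alpha_c}{\alpha_c+\alpha_p}\int_0^u\varphi(u-z)\,dF(z)+\frac{\alpha_p}{\alpha_c+\alpha_p}\int_0^{+\infty}\varphi(u+z)\,dG(z),$$ with Lebesgue–Stieltjes integrals, endpoints included. *)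

theory Defs
  imports "HOL-Probability.Probability"
begin

text \<open>
  \<^term>\<open>interval_measure F\<close> is the Lebesgue--Stieltjes measure of \<open>F\<close> on the whole real line, so the
  closed sets of integration \<open>{0..u}\<close> and \<open>{0..}\<close> take an atom at \<open>0\<close> (or at \<open>u\<close>) into account.
  Only the values of \<open>\<phi>\<close> on \<open>{0..}\<close> enter when \<open>u \<ge> 0\<close>.
\<close>

definition A1 ::
  "real \<Rightarrow> real \<Rightarrow> (real \<Rightarrow> real) \<Rightarrow> (real \<Rightarrow> real) \<Rightarrow> (real \<Rightarrow> real) \<Rightarrow> real \<Rightarrow> real" where
  "A1 \<alpha>\<^sub>c \<alpha>\<^sub>p F G \<phi> u =
     \<alpha>\<^sub>c / (\<alpha>\<^sub>c + \<alpha>\<^sub>p) * (LINT z:{0..u}|interval_measure F. \<phi> (u - z)) +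
     \<alpha>\<^sub>p / (\<alpha>\<^sub>c + \<alpha>\<^sub>p) * (LINT z:{0..}|interval_measure G. \<phi> (u + z))"

definition phi_star :: "real \<Rightarrow> real \<Rightarrow> real" where
  "phi_star L u = 1 - exp (- L * u)"

end

theory Submission imports Defs "HOL-Real_Asymp.Real_Asymp" begin

text \<open>
  For \<open>z > u\<close> the extended function \<open>1 - exp (- L * (u - z))\<close> is negative, so truncating
  the claim integral at \<open>u\<close>
  only increases it. Hence \<open>A\<^sub>1 \<phi>\<^sub>*(u) \<ge> 1 - exp (- L * u) * m\<close>,
  where \<open>m\<close> is the left-hand side of the
  Lundberg-type condition \<open>m \<le> 1\<close>.
\<close>

text \<open>A probability measure on the line is determined by its cdf. This turns integrals against
  \<open>interval_measure F\<close> and \<open>interval_measure G\<close> into integrals against the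
  laws of \<open>X\<close> and \<open>Y\<close>.\<close>

lemma interval_measure_cdf:
  assumes "real_distribution P"
  shows "interval_measure (cdf P) = P"
proof -
  interpret P: real_distribution P by fact
  have "real_distribution (interval_measure (cdf P))"
    by (intro real_distribution_interval_measure P.cdf_nondecreasing P.cdf_is_right_cont
        P.cdf_lim_at_top_prob P.cdf_lim_at_bot)
  moreover have "cdf (interval_measure (cdf P)) = cdf P"
    by (intro cdf_interval_measure P.cdf_nondecreasing P.cdf_is_right_cont
        P.cdf_lim_at_top_prob P.cdf_lim_at_bot)
  ultimately show ?thesis
    using cdf_unique assms by blast
qed

lemma real_distribution_distr_nonneg:
  assumes "prob_space M" and X: "X \<in> borel_measurable M" and "\<forall>\<omega>\<in>space M. (0::real) \<le> X \<omega>"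
  shows "real_distribution (distr M borel X)" and "AE z in distr M borel X. 0 \<le> z"
proof -
  interpret prob_space M by fact
  show "real_distribution (distr M borel X)"
    using X by simp
  show "AE z in distr M borel X. 0 \<le> z"
    using assms by (subst AE_distr_iff) auto
qed

text \<open>Since exp (- L * (u - z)) factors as exp (- L * u) * exp (L * z), the right-hand side is
  the integral of \<open>phi_star L (u - z)\<close> over the whole line; restricting it to
  \<open>{0..u}\<close> discards only nonpositive values and a null set.\<close>

lemma phi_star_diff_integral_ge:
  assumes "real_distribution P" and nonneg: "AE z in P. 0 \<le> z" and "L > 0"
    and int: "integrable P (\<lambda>z. exp (L * z))"
  shows "(LINT z:{0..u}|P. phi_star L (u - z)) \<ge> 1 - exp (- L * u) * (LINT z|P. exp (L * z))"
proof -
  interpret P: real_distribution P by fact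
  have split: "phi_star L (u - z) = 1 - exp (- L * u) * exp (L * z)" for z
    by (simp add: phi_star_def algebra_simps flip: exp_add)
  have int': "integrable P (\<lambda>z. phi_star L (u - z))"
    unfolding split using int by simp
  have "1 - exp (- L * u) * (LINT z|P. exp (L * z)) = (LINT z|P. phi_star L (u - z))"
    unfolding split using int by (simp add: P.prob_space[simplified])
  also have "\<dots> \<le> (LINT z:{0..u}|P. phi_star L (u - z))"
    unfolding set_lebesgue_integral_def
  proof (rule integral_mono_AE)
    show "integrable P (\<lambda>z. indicator {0..u} z *\<^sub>R phi_star L (u - z))"
      using int' by (intro integrable_mult_indicator) auto
    \<comment> \<open>Almost surely z \<ge> 0, so the two sides can differ only for z > u, where the
      right one is 0.\<close>
    show "AE z in P. phi_star L (u - z) \<le> indicator {0..u} z *\<^sub>R phi_star L (u - z)"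
      using nonneg
    proof eventually_elim
      case (elim z)
      have "phi_star L (u - z) \<le> 0" if "z > u"
        using that \<open>L > 0\<close> by (simp add: phi_star_def mult_le_0_iff)
      then show ?case using elim by (auto simp: indicator_def)
    qed
  qed (fact int')
  finally show ?thesis .
qed

text \<open>The same factorisation as for claims, but \<open>{0..}\<close> carries all the mass of
  \<open>Q\<close>: nothing is truncated, hence an equality.\<close>

lemma phi_star_add_integral_eq:
  assumes "real_distribution Q" and nonneg: "AE z in Q. 0 \<le> z"
    and int: "integrable Q (\<lambda>z. exp (- L * z))"
  shows "(LINT z:{0..}|Q. phi_star L (u + z)) = 1 - exp (- L * u) * (LINT z|Q. exp (- L * z))"
proof -
  interpret Q: real_distribution Q by fact
  have split: "phi_star L (u + z) = 1 - exp (- L * u) * exp (- L * z)" for z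
    by (simp add: phi_star_def algebra_simps flip: exp_add)
  have int': "integrable Q (\<lambda>z. phi_star L (u + z))"
    unfolding split using int by simp
  then have [measurable]: "(\<lambda>z. phi_star L (u + z)) \<in> borel_measurable Q"
    by simp
  have "(LINT z:{0..}|Q. phi_star L (u + z)) = (LINT z|Q. phi_star L (u + z))"
    unfolding set_lebesgue_integral_def using nonneg
    by (intro integral_cong_AE) (auto elim!: eventually_mono)
  also have "\<dots> = 1 - exp (- L * u) * (LINT z|Q. exp (- L * z))"
    unfolding split using int by (simp add: Q.prob_space[simplified])
  finally show ?thesis .
qed

theorem lemma6p4:
  fixes \<alpha>\<^sub>c \<alpha>\<^sub>p L\<^sub>1 :: real
    and F G :: "real \<Rightarrow> real"
    and M :: "'a measure" and X :: "'a \<Rightarrow> real"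
    and N :: "'b measure" and Y :: "'b \<Rightarrow> real"
  assumes "\<alpha>\<^sub>c > 0" and "\<alpha>\<^sub>p > 0"
    and "prob_space M" and "X \<in> borel_measurable M" and "\<forall>\<omega>\<in>space M. 0 \<le> X \<omega>"
    and "F = cdf (distr M borel X)"
    and "prob_space N" and "Y \<in> borel_measurable N" and "\<forall>\<omega>\<in>space N. 0 \<le> Y \<omega>"
    and "G = cdf (distr N borel Y)"
    and "L\<^sub>1 > 0"
    and "ennreal (\<alpha>\<^sub>c / (\<alpha>\<^sub>c + \<alpha>\<^sub>p)) * (\<integral>\<^sup>+z\<in>{0..}. ennreal (exp (L\<^sub>1 * z)) \<partial>interval_measure F)
         + ennreal (\<alpha>\<^sub>p / (\<alpha>\<^sub>c + \<alpha>\<^sub>p)) * (\<integral>\<^sup>+z\<in>{0..}. ennreal (exp (- L\<^sub>1 * z)) \<partial>interval_measure G)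
         \<le> 1"
    and "((\<lambda>z. exp (L\<^sub>1 * z) * (1 - F z)) \<longlongrightarrow> 0) at_top"
  shows "mono_on {0..} (phi_star L\<^sub>1)
    \<and> (\<forall>u\<ge>0. 0 \<le> phi_star L\<^sub>1 u \<and> phi_star L\<^sub>1 u \<le> 1)
    \<and> (phi_star L\<^sub>1 \<longlongrightarrow> 1) at_top
    \<and> (\<forall>u\<ge>0. A1 \<alpha>\<^sub>c \<alpha>\<^sub>p F G (phi_star L\<^sub>1) u \<ge> phi_star L\<^sub>1 u)"
proof -
  define P where "P = distr M borel X"
  define Q where "Q = distr N borel Y"
  have P: "real_distribution P" "AE z in P. 0 \<le> z"
    using real_distribution_distr_nonneg assms unfolding P_def by blast+
  have Q: "real_distribution Q" "AE z in Q. 0 \<le> z"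
    using real_distribution_distr_nonneg assms unfolding Q_def by blast+
  interpret P: real_distribution P by fact
  interpret Q: real_distribution Q by fact
  define c where "c = \<alpha>\<^sub>c / (\<alpha>\<^sub>c + \<alpha>\<^sub>p)"
  define p where "p = \<alpha>\<^sub>p / (\<alpha>\<^sub>c + \<alpha>\<^sub>p)"
  have cp: "c > 0" "p > 0" "c + p = 1"
    using assms(1,2) by (auto simp: c_def p_def simp flip: add_divide_distrib)
  have F: "interval_measure F = P" and G: "interval_measure G = Q"
    using assms(6,10) P(1) Q(1) by (simp_all add: P_def Q_def interval_measure_cdf)
  have "(\<integral>\<^sup>+z\<in>{0..}. ennreal (exp (L\<^sub>1 * z)) \<partial>P) = (\<integral>\<^sup>+z. ennreal (exp (L\<^sub>1 * z)) \<partial>P)"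
    using P(2) by (intro nn_integral_cong_AE) (auto elim!: eventually_mono)
  moreover have "(\<integral>\<^sup>+z\<in>{0..}. ennreal (exp (- L\<^sub>1 * z)) \<partial>Q) = (\<integral>\<^sup>+z. ennreal (exp (- L\<^sub>1 * z)) \<partial>Q)"
    using Q(2) by (intro nn_integral_cong_AE) (auto elim!: eventually_mono)
  ultimately have le1: "ennreal c * (\<integral>\<^sup>+z. ennreal (exp (L\<^sub>1 * z)) \<partial>P)
      + ennreal p * (\<integral>\<^sup>+z. ennreal (exp (- L\<^sub>1 * z)) \<partial>Q) \<le> 1"
    using assms(12) by (simp add: F G c_def p_def)
  \<comment> \<open>The condition itself forces a finite exponential moment: as c > 0, an infinite
    one would make the left-hand side infinite. A Bochner integral would default to 0 there, so this
    precedes the passage to real numbers.\<close>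
  have intP: "integrable P (\<lambda>z. exp (L\<^sub>1 * z))"
  proof (rule integrableI_nonneg)
    show "(\<integral>\<^sup>+z. ennreal (exp (L\<^sub>1 * z)) \<partial>P) < \<infinity>"
    proof (rule ccontr)
      assume "\<not> ?thesis"
      then have "(\<integral>\<^sup>+z. ennreal (exp (L\<^sub>1 * z)) \<partial>P) = \<top>"
        by (simp flip: top.not_eq_extremum)
      with le1 cp show False
        by (simp add: ennreal_mult_top top_unique)
    qed
  qed auto
  \<comment> \<open>For z \<ge> 0 the integrand is at most 1, and \<open>Q\<close> is a finite
    measure.\<close>
  have intQ: "integrable Q (\<lambda>z. exp (- L\<^sub>1 * z))"
    using Q(2) assms(11)
    by (intro Q.integrable_const_bound[where B = 1]) (auto elim!: eventually_mono)
  define m where "m = c * (LINT z|P. exp (L\<^sub>1 * z)) + p * (LINT z|Q. exp (- L\<^sub>1 * z))"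
  \<comment> \<open>With both moments finite, \<open>ennreal m\<close> is exactly the left-hand side
    of \<open>le1\<close>.\<close>
  have "ennreal m \<le> 1"
    using le1 cp intP intQ
    by (simp add: m_def nn_integral_eq_integral ennreal_plus ennreal_mult)
  then have "m \<le> 1"
    by simp
  have "A1 \<alpha>\<^sub>c \<alpha>\<^sub>p F G (phi_star L\<^sub>1) u \<ge> phi_star L\<^sub>1 u" for u
  proof -
    have "phi_star L\<^sub>1 u \<le> 1 - exp (- L\<^sub>1 * u) * m"
      using \<open>m \<le> 1\<close> by (simp add: phi_star_def)
    \<comment> \<open>Writing 1 as c + p shares the constant between the two weights, so that each
      bracket matches one of the two integral lemmas.\<close>
    also have "\<dots> = (c + p) - exp (- L\<^sub>1 * u) * m"
      by (simp only: cp(3))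
    also have "\<dots> = c * (1 - exp (- L\<^sub>1 * u) * (LINT z|P. exp (L\<^sub>1 * z)))
        + p * (1 - exp (- L\<^sub>1 * u) * (LINT z|Q. exp (- L\<^sub>1 * z)))"
      by (simp add: m_def algebra_simps)
    also have "\<dots> \<le> c * (LINT z:{0..u}|P. phi_star L\<^sub>1 (u - z))
        + p * (LINT z:{0..}|Q. phi_star L\<^sub>1 (u + z))"
      using phi_star_diff_integral_ge[OF P assms(11) intP, of u]
        phi_star_add_integral_eq[OF Q intQ, of u] cp
      by (intro add_mono mult_left_mono) auto
    finally show ?thesis
      by (simp add: A1_def F G c_def p_def)
  qed
  moreover have "mono_on {0..} (phi_star L\<^sub>1)"
    using assms(11) by (auto intro!: mono_onI simp: phi_star_def)
  moreover have "0 \<le> phi_star L\<^sub>1 u \<and> phi_star L\<^sub>1 u \<le> 1" if "u \<ge> 0" for u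
    using assms(11) that by (simp add: phi_star_def)
  moreover have "(phi_star L\<^sub>1 \<longlongrightarrow> 1) at_top"
    unfolding phi_star_def using assms(11) by real_asymp
  ultimately show ?thesis
    by blast
qed

end
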